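(* Let $q$ be an odd prime power, $\mathbb{A}=\mathbb{F}_q[X]$, and $S\subseteq\mathbb{F}_q^*$ any set with $|S|=(q-1)/2$ such that $\alpha\in S$ implies $-\alpha\notin S$. If $f\in\mathbb{A}$ has prime factorization $f=aP_1^{e_1}\cdots P_t^{e_t}$ ($a\in\mathbb{F}_q^*$, $P_j$ distinct monic irreducible, $e_j\ge1$) with $t\ge3$, then $G(f,S)\equiv1\pmod f$.
   Context: For non-zero $g\in\mathbb{A}$, $\mathrm{sgn}(g)$ is the leading coefficient of $g$. $G(f,S)=\prod g$, the product over all non-zero $g\in\mathbb{A}$ with $\mathrm{sgn}(g)\in S$, $0\le\deg g<\deg f$, $\gcd(g,f)=1$. *)

theory Defs
  imports
    "HOL-Library.Cardinality"
    "HOL-Computational_Algebra.Polynomial"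
    "HOL-Number_Theory.Cong"
begin

(* A finite field is a type of sort {field, finite}; its cardinality is CARD('a).
   The class field provides no canonical gcd on 'a poly, so "gcd(g, f) = 1" is coprime g f,
   which does not depend on the choice of a gcd. *)

definition G_index :: "'a::{field,finite} poly \<Rightarrow> 'a set \<Rightarrow> 'a poly set" where
  "G_index f S = {g. g \<noteq> 0 \<and> lead_coeff g \<in> S \<and> degree g < degree f \<and> coprime g f}"

definition G :: "'a::{field,finite} poly \<Rightarrow> 'a set \<Rightarrow> 'a poly" where
  "G f S = (\<Prod>g\<in>G_index f S. g)"

(* The product above is a genuine one: prod over an infinite set would be 1 by convention. *)
lemma finite_G_index: "finite (G_index f S)"
proof (rule finite_subset)
  show "G_index f S \<subseteq> Poly ` {xs. set xs \<subseteq> UNIV \<and> length xs \<le> degree f}"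
  proof
    fix g assume "g \<in> G_index f S"
    then have "length (coeffs g) \<le> degree f"
      by (auto simp: G_index_def length_coeffs_degree)
    then show "g \<in> Poly ` {xs. set xs \<subseteq> UNIV \<and> length xs \<le> degree f}"
      by (intro image_eqI[of _ _ "coeffs g"]) auto
  qed
  show "finite (Poly ` {xs :: 'a list. set xs \<subseteq> UNIV \<and> length xs \<le> degree f})"
    by (intro finite_imageI finite_lists_length_le) simp
qed

end

theory Submission
  imports Defs "HOL-Computational_Algebra.Polynomial_Factorial"
begin

text \<open>
  It suffices to work modulo one prime power $Q = P_i^{e_i}$. Sieve out the primes one at a time:
  let $F_X(N)$ be the product, and $c_X(N)$ the number, of the polynomials of degree below $N$ with
  leading coefficient in $S$ that no prime of $X$ divides. For a new monic prime $p$,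
  $$F_X(N) = F_{X \cup \{p\}}(N) \cdot p^{c_X(N - \deg p)} \cdot F_X(N - \deg p),$$
  and correspondingly for $c_X$. Let $w$ be the product of the units modulo $Q$, so $w^2 = 1$.
  For $X = \{P_i\}$ and $N \ge \deg Q$, division by $Q$ shows that $c_X(N)$ is constant modulo the
  number of units and that each increment of $N$ multiplies $F_X(N)$ by $w^{|S|}$ ($q$ is odd).
  With one more prime, the recursion makes $F_X(N)$ independent of $N$ modulo $Q$
  and $c_X(N)$ divisible by the number of units; with a second one it then gives
  $F_X(N) \equiv 1$, and this persists for all further primes.
\<close>

section \<open>Counting polynomials of bounded degree\<close>

text \<open>Coefficients are used instead of \<open>degree k < n\<close> so that the zero polynomial
  is included for \<open>n = 0\<close> too; the set is then a vector space of dimension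
  \<open>n\<close>.\<close>

definition bounded_polys :: "nat \<Rightarrow> 'a::{field,finite} poly set" where
  "bounded_polys n = {k. \<forall>i\<ge>n. coeff k i = 0}"

lemma bounded_polys_0: "bounded_polys 0 = {0}"
  by (auto simp: bounded_polys_def poly_eq_iff)

lemma bounded_polys_Suc:
  "bounded_polys (Suc n) = (\<lambda>(a, k). pCons a k) ` (UNIV \<times> bounded_polys n)"
proof (intro equalityI subsetI)
  fix g :: "'a poly" assume g: "g \<in> bounded_polys (Suc n)"
  obtain a k where "g = pCons a k" by (cases g)
  moreover from this g have "k \<in> bounded_polys n"
    by (force simp: bounded_polys_def dest: spec[of _ "Suc _"])
  ultimately show "g \<in> (\<lambda>(a, k). pCons a k) ` (UNIV \<times> bounded_polys n)" by auto
qed (auto simp: bounded_polys_def coeff_pCons split: nat.split)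

lemma finite_bounded_polys [simp]: "finite (bounded_polys n)"
  by (induction n) (simp_all add: bounded_polys_0 bounded_polys_Suc)

lemma card_bounded_polys: "card (bounded_polys n :: 'a::{field,finite} poly set) = CARD('a) ^ n"
proof (induction n)
  case (Suc n)
  have "inj_on (\<lambda>(a, k). pCons a k) (UNIV \<times> (bounded_polys n :: 'a poly set))"
    by (auto simp: inj_on_def)
  then show ?case
    using Suc by (simp add: bounded_polys_Suc card_image card_cartesian_product)
qed (simp add: bounded_polys_0)

lemma degree_less_imp_bounded: "degree k < n \<Longrightarrow> k \<in> bounded_polys n"
  by (simp add: bounded_polys_def coeff_eq_0)

text \<open>Splitting off the leading monomial leaves a free choice of an element of
  \<open>S\<close> and of \<open>m\<close> lower coefficients. As \<open>0 \<notin> S\<close>, the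
  chosen top coefficient never vanishes, so the degree is exactly \<open>m\<close>.\<close>

lemma card_degree_lead_coeff:
  fixes S :: "'a::{field,finite} set"
  assumes "0 \<notin> S"
  shows "card {l. degree l = m \<and> lead_coeff l \<in> S} = card S * CARD('a) ^ m"
proof -
  have "bij_betw (\<lambda>(s, k). monom s m + k) (S \<times> bounded_polys m)
      {l. degree l = m \<and> lead_coeff l \<in> S}"
  proof (rule bij_betw_byWitness[where f' = "\<lambda>l. (lead_coeff l, l - monom (lead_coeff l) m)"])
    have *: "degree (monom s m + k) = m" "lead_coeff (monom s m + k) = s"
      if "s \<in> S" "k \<in> bounded_polys m" for s and k :: "'a poly"
    proof -
      from that assms have "coeff (monom s m + k) m = s" "s \<noteq> 0"
        by (auto simp: bounded_polys_def)
      moreover from that have "degree (monom s m + k) \<le> m"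
        by (intro degree_le) (auto simp: bounded_polys_def)
      ultimately show "degree (monom s m + k) = m" "lead_coeff (monom s m + k) = s"
        by (metis le_antisym le_degree)+
    qed
    show "(\<lambda>(s, k). monom s m + k) ` (S \<times> bounded_polys m)
        \<subseteq> {l. degree l = m \<and> lead_coeff l \<in> S}"
      using * by auto
    show "\<forall>x\<in>S \<times> bounded_polys m. (\<lambda>l. (lead_coeff l, l - monom (lead_coeff l) m))
        ((\<lambda>(s, k). monom s m + k) x) = x"
      using * by auto
  qed (auto simp: bounded_polys_def coeff_eq_0)
  from bij_betw_same_card[OF this, symmetric] show ?thesis
    by (simp only: card_cartesian_product card_bounded_polys)
qed

section \<open>Sieving by a set of primes\<close>

text \<open>The index set of \<open>G f S\<close> arises when \<open>X\<close> is the set of monic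
  primes of \<open>f\<close> and \<open>N = degree f\<close>. The bound \<open>N\<close> is kept
  independent of \<open>X\<close> because the recursion lowers it.\<close>

definition sieve :: "'a::{field,finite} set \<Rightarrow> 'a poly set \<Rightarrow> nat \<Rightarrow> 'a poly set" where
  "sieve S X N = {g. g \<noteq> 0 \<and> lead_coeff g \<in> S \<and> degree g < N \<and> (\<forall>p\<in>X. \<not> p dvd g)}"

lemma finite_sieve [simp]: "finite (sieve S X N)"
  by (rule finite_subset[OF _ finite_bounded_polys[of N]])
     (auto simp: sieve_def degree_less_imp_bounded)

text \<open>The members divisible by \<open>p\<close> are the products \<open>p * h\<close>. Since
  \<open>p\<close> is monic the leading coefficient passes to \<open>h\<close>, and since no prime
  of \<open>X\<close> divides \<open>p\<close> the sieving condition does as well.\<close>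

lemma sieve_insert:
  assumes "lead_coeff p = 1" and "\<forall>x\<in>X. prime_elem x \<and> \<not> x dvd p"
  shows "sieve S X N = sieve S (insert p X) N \<union> (*) p ` sieve S X (N - degree p)"
    and "sieve S (insert p X) N \<inter> (*) p ` sieve S X (N - degree p) = {}"
proof -
  have "p \<noteq> 0" using assms(1) by auto
  \<comment> \<open>Truncated subtraction is harmless: for \<open>N \<le> degree p\<close> the
    right-hand sieve is empty, and no nonzero multiple of \<open>p\<close> has degree below
    \<open>N\<close>.\<close>
  have *: "p * h \<in> sieve S X N \<longleftrightarrow> h \<in> sieve S X (N - degree p)" for h
    using assms \<open>p \<noteq> 0\<close>
    by (cases "h = 0")
       (auto simp: sieve_def degree_mult_eq coeff_mult_degree_sum prime_elem_dvd_mult_iff)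
  have "sieve S X N = {g \<in> sieve S X N. \<not> p dvd g} \<union> {g \<in> sieve S X N. p dvd g}"
    by blast
  also have "{g \<in> sieve S X N. \<not> p dvd g} = sieve S (insert p X) N"
    by (auto simp: sieve_def)
  also have "{g \<in> sieve S X N. p dvd g} = (*) p ` sieve S X (N - degree p)"
    using * by (auto elim!: dvdE)
  finally show "sieve S X N = sieve S (insert p X) N \<union> (*) p ` sieve S X (N - degree p)" .
  show "sieve S (insert p X) N \<inter> (*) p ` sieve S X (N - degree p) = {}"
    by (auto simp: sieve_def)
qed

lemma
  assumes "lead_coeff p = 1" and "\<forall>x\<in>X. prime_elem x \<and> \<not> x dvd p"
  shows card_sieve_insert:
      "card (sieve S X N) = card (sieve S (insert p X) N) + card (sieve S X (N - degree p))"
    and prod_sieve_insert: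
      "\<Prod>(sieve S X N) = \<Prod>(sieve S (insert p X) N) *
        (p ^ card (sieve S X (N - degree p)) * \<Prod>(sieve S X (N - degree p)))"
proof -
  have "p \<noteq> 0" using assms(1) by auto
  then have inj: "inj_on ((*) p) A" for A by (auto simp: inj_on_def)
  note split = sieve_insert[OF assms, where S = S and N = N]
  show "card (sieve S X N) = card (sieve S (insert p X) N) + card (sieve S X (N - degree p))"
    using card_Un_disjoint[OF _ _ split(2)] by (simp add: split(1)[symmetric] card_image[OF inj])
  show "\<Prod>(sieve S X N) = \<Prod>(sieve S (insert p X) N) *
      (p ^ card (sieve S X (N - degree p)) * \<Prod>(sieve S X (N - degree p)))"
    using prod.union_disjoint[OF _ _ split(2), where g = "\<lambda>x. x"]
    by (simp add: split(1)[symmetric] prod.reindex[OF inj] prod.distrib)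
qed

section \<open>Division with remainder by a monic modulus\<close>

text \<open>The quotient carries the degree and the leading coefficient, because \<open>Q\<close> is
  monic; the remainder carries divisibility by \<open>P\<close>, because \<open>P dvd Q\<close>. The
  two conditions on \<open>g\<close> thus become independent.\<close>

lemma division_bij:
  fixes Q :: "'a::{field,finite} poly"
  assumes Q: "lead_coeff Q = 1" "degree Q > 0" and "P dvd Q" "N \<ge> degree Q" "0 \<notin> S"
  shows "bij_betw (\<lambda>(l, r). r + Q * l)
    ({l. degree l = N - degree Q \<and> lead_coeff l \<in> S} \<times> {r. degree r < degree Q \<and> \<not> P dvd r})
    {g. degree g = N \<and> lead_coeff g \<in> S \<and> \<not> P dvd g}"
    (is "bij_betw _ (?L \<times> ?U) ?B")
proof (rule bij_betw_byWitness[where f' = "\<lambda>g. (g div Q, g mod Q)"])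
  have Q0: "Q \<noteq> 0" using Q by auto
  show "\<forall>a\<in>?L \<times> ?U. (\<lambda>g. (g div Q, g mod Q)) ((\<lambda>(l, r). r + Q * l) a) = a"
    using Q0 by (auto simp: div_poly_less mod_poly_less)
  have *: "r + Q * l \<in> ?B" if l: "l \<in> ?L" and r: "r \<in> ?U" for l r
  proof -
    have "l \<noteq> 0" using l assms(5) by auto
    then have d: "degree (Q * l) = N"
      using l Q0 assms(4) by (simp add: degree_mult_eq)
    have less: "degree r < degree (Q * l)"
      using d r assms(4) by simp
    have "lead_coeff l \<in> S" using l by blast
    then have "lead_coeff (Q * l) \<in> S"
      by (simp only: lead_coeff_mult Q(1) mult_1_left)
    moreover have "\<not> P dvd r + Q * l"
      using r assms(3) by (simp add: dvd_add_left_iff)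
    ultimately show ?thesis
      using d degree_add_eq_right[OF less] lead_coeff_add_le[OF less] by simp
  qed
  have "(case x of (l, r) \<Rightarrow> r + Q * l) \<in> ?B" if "x \<in> ?L \<times> ?U" for x
  proof -
    from that obtain l r where x: "x = (l, r)" "l \<in> ?L" "r \<in> ?U" by (rule SigmaE)
    show ?thesis unfolding x(1) prod.case by (rule *[OF x(2,3)])
  qed
  then show "(\<lambda>(l, r). r + Q * l) ` (?L \<times> ?U) \<subseteq> ?B" by (rule image_subsetI)
  have "(g div Q, g mod Q) \<in> ?L \<times> ?U" if g: "g \<in> ?B" for g
  proof -
    have r: "g mod Q \<in> ?U"
      using g degree_mod_less[OF Q0, of g] Q(2) dvd_mod_iff[OF assms(3), of g] by auto
    have "g div Q \<noteq> 0"
      using assms g Q0 by (auto simp: div_poly_eq_0_iff)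
    then have d: "degree (Q * (g div Q)) = degree Q + degree (g div Q)"
      using Q0 by (intro degree_mult_eq)
    then have less: "degree (g mod Q) < degree (Q * (g div Q))"
      using r by simp
    have "degree g = degree Q + degree (g div Q)"
      using degree_add_eq_right[OF less] d by simp
    moreover have "lead_coeff g = lead_coeff (g div Q)"
      using lead_coeff_add_le[OF less] Q(1) by (simp add: lead_coeff_mult)
    ultimately show ?thesis using r g by auto
  qed
  then show "(\<lambda>g. (g div Q, g mod Q)) ` ?B \<subseteq> ?L \<times> ?U" by (rule image_subsetI)
qed simp

lemma prime_elem_not_dvd_prod:
  fixes p :: "'b::comm_semiring_1"
  assumes "prime_elem p" "\<And>x. x \<in> A \<Longrightarrow> \<not> p dvd f x"
  shows "\<not> p dvd prod f A"
  using assms(2)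
proof (induction A rule: infinite_finite_induct)
  case (insert x A)
  then show ?case using assms(1) by (simp add: prime_elem_dvd_mult_iff)
qed (use assms(1) in \<open>auto simp: prime_elem_not_unit\<close>)

section \<open>The unit group modulo a prime power\<close>

locale prime_power =
  fixes P :: "'a::{field,finite} poly" and e :: nat
  assumes prime: "prime_elem P" and monic: "lead_coeff P = 1" and e_pos: "e > 0"
begin

text \<open>Reduced representatives of the units of the residue ring modulo
  \<open>P ^ e\<close>.\<close>

definition units :: "'a poly set" where
  "units = {g. degree g < degree (P ^ e) \<and> \<not> P dvd g}"

lemma power_nonzero [simp]: "P ^ e \<noteq> 0"
  using prime by auto

lemma monic_power: "lead_coeff (P ^ e) = 1"
  by (simp add: lead_coeff_power monic)

lemma dvd_power_self: "P dvd P ^ e"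
  using e_pos by auto

lemma finite_units [simp]: "finite units"
  by (rule finite_subset[OF _ finite_bounded_polys[of "degree (P ^ e)"]])
     (auto simp: units_def degree_less_imp_bounded)

lemma degree_pos: "degree (P ^ e) > 0"
proof -
  have "P \<noteq> 0" "\<not> is_unit P" using prime by (auto simp: prime_elem_not_unit)
  then show ?thesis using e_pos by (simp add: degree_power_eq is_unit_iff_degree)
qed

lemma cong_cancel:
  assumes "[x * a = x * b] (mod P ^ e)" "\<not> P dvd x"
  shows "[a = b] (mod P ^ e)"
proof -
  have "P ^ e dvd x * (a - b)"
    using assms(1) by (simp add: cong_iff_dvd_diff right_diff_distrib)
  then show ?thesis
    using assms(2) prime e_pos by (auto simp: cong_iff_dvd_diff dest: prime_power_dvd_multD)
qed

lemma mod_units: "\<not> P dvd x \<Longrightarrow> x mod P ^ e \<in> units"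
  using degree_pos degree_mod_less[OF power_nonzero, of x] dvd_mod_iff[OF dvd_power_self, of x]
  by (auto simp: units_def)

lemma mod_units_self: "x \<in> units \<Longrightarrow> x mod P ^ e = x"
  by (simp add: units_def mod_poly_less)

text \<open>Cancellation gives injectivity, and finiteness of \<open>units\<close> then gives
  surjectivity.\<close>

lemma units_mult_bij:
  assumes "\<not> P dvd x"
  shows "bij_betw (\<lambda>u. x * u mod P ^ e) units units"
proof -
  have "inj_on (\<lambda>u. x * u mod P ^ e) units"
  proof (rule inj_onI)
    fix u v assume "u \<in> units" "v \<in> units" "x * u mod P ^ e = x * v mod P ^ e"
    then show "u = v"
      using cong_cancel[of x u v] assms by (simp add: cong_def mod_units_self)
  qed
  moreover have "(\<lambda>u. x * u mod P ^ e) ` units \<subseteq> units"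
    using assms prime by (auto intro!: mod_units simp: prime_elem_dvd_mult_iff) (auto simp: units_def)
  ultimately show ?thesis
    by (intro bij_betw_imageI endo_inj_surj finite_units)
qed

lemmas not_dvd_prod = prime_elem_not_dvd_prod[OF prime]

lemma not_dvd_power: "\<not> P dvd x \<Longrightarrow> \<not> P dvd x ^ n"
  using prime prime_elem_dvd_power by blast

lemma not_dvd_prod_units: "\<not> P dvd \<Prod>units"
  by (rule not_dvd_prod) (simp add: units_def)

text \<open>Euler's theorem for this group: multiplication by \<open>x\<close> permutes the units,
  so comparing the product of all units before and after leaves
  \<open>x ^ card units\<close>.\<close>

lemma fermat:
  assumes "\<not> P dvd x"
  shows "[x ^ card units = 1] (mod P ^ e)"
proof -
  have "\<Prod>units = (\<Prod>u\<in>units. x * u mod P ^ e)"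
    using prod.reindex_bij_betw[OF units_mult_bij[OF assms], of "\<lambda>u. u"] by simp
  also have "[\<dots> = (\<Prod>u\<in>units. x * u)] (mod P ^ e)"
    by (intro cong_prod) simp
  finally have "[\<Prod>units * 1 = \<Prod>units * x ^ card units] (mod P ^ e)"
    by (simp add: prod.distrib mult.commute)
  then show ?thesis
    using cong_cancel not_dvd_prod_units cong_sym by blast
qed

text \<open>Inversion permutes the units, so the square is a product of pairs
  \<open>u * v u\<close>, each congruent to 1.\<close>

lemma prod_units_square: "[\<Prod>units ^ 2 = 1] (mod P ^ e)"
proof -
  have "\<exists>v\<in>units. [u * v = 1] (mod P ^ e)" if "u \<in> units" for u
  proof -
    have "1 \<in> units"
      using degree_pos prime by (simp add: units_def prime_elem_not_unit)
    moreover have "(\<lambda>v. u * v mod P ^ e) ` units = units"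
      using units_mult_bij[of u] that by (simp add: bij_betw_def units_def)
    ultimately obtain v where "v \<in> units" "u * v mod P ^ e = 1"
      by (metis (no_types, lifting) imageE)
    then show ?thesis
      using mod_units_self[OF \<open>1 \<in> units\<close>] by (auto simp: cong_def)
  qed
  then obtain v where v: "\<And>u. u \<in> units \<Longrightarrow> v u \<in> units \<and> [u * v u = 1] (mod P ^ e)"
    by metis
  have "inj_on v units"
  proof (rule inj_onI)
    fix x y assume xy: "x \<in> units" "y \<in> units" "v x = v y"
    then have "[v x * x = v x * y] (mod P ^ e)"
      using v[of x] v[of y] by (metis cong_sym cong_trans mult.commute)
    then have "[x = y] (mod P ^ e)"
      using cong_cancel v[of x] xy by (auto simp: units_def)
    then show "x = y" using xy by (simp add: cong_def mod_units_self)
  qed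
  moreover have "v ` units \<subseteq> units" using v by auto
  ultimately have "bij_betw v units units"
    by (intro bij_betw_imageI endo_inj_surj finite_units)
  then have "\<Prod>units ^ 2 = (\<Prod>u\<in>units. u * v u)"
    using prod.reindex_bij_betw[of v units units "\<lambda>u. u"]
    by (simp add: power2_eq_square prod.distrib)
  also have "[\<dots> = (\<Prod>u\<in>units. 1)] (mod P ^ e)"
    using v by (intro cong_prod) auto
  finally show ?thesis by simp
qed

lemma power_prod_units_cong:
  assumes "even m = even n"
  shows "[\<Prod>units ^ m = \<Prod>units ^ n] (mod P ^ e)"
proof -
  have "[\<Prod>units ^ m = \<Prod>units ^ (m mod 2)] (mod P ^ e)" for m
  proof -
    have "[(\<Prod>units ^ 2) ^ (m div 2) * \<Prod>units ^ (m mod 2)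
        = 1 ^ (m div 2) * \<Prod>units ^ (m mod 2)] (mod P ^ e)"
      by (intro cong_mult cong_pow prod_units_square) simp
    then show ?thesis
      by (simp flip: power_mult power_add)
  qed
  moreover have "m mod 2 = n mod 2" using assms by presburger
  ultimately show ?thesis by (metis cong_sym cong_trans)
qed

lemma power_cong_exponent:
  assumes "\<not> P dvd x" "[m = n] (mod card units)"
  shows "[x ^ m = x ^ n] (mod P ^ e)"
proof -
  obtain k l where "m + k * card units = n + l * card units"
    using assms(2) cong_iff_lin_nat by (metis)
  then have eq: "x ^ m * (x ^ card units) ^ k = x ^ n * (x ^ card units) ^ l"
    by (simp flip: power_mult power_add add: mult.commute)
  have *: "[x ^ n * (x ^ card units) ^ k = x ^ n] (mod P ^ e)" for n k
    using cong_mult[OF cong_refl cong_pow[OF fermat[OF assms(1)]], of "x ^ n" k] by simp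
  show ?thesis
    using cong_trans[OF cong_sym[OF *[of m k]], unfolded eq, OF *] .
qed

section \<open>The sieve by the single prime \<open>P\<close>, modulo \<open>P ^ e\<close>\<close>

text \<open>The new layer consists of the polynomials of degree exactly \<open>N\<close>. By
  \<open>division_bij\<close> each unit is the remainder of equally many of them, one for each
  admissible quotient.\<close>

lemma
  assumes N: "N \<ge> degree (P ^ e)" and S: "0 \<notin> S"
  shows card_sieve_Suc: "card (sieve S {P} (Suc N))
      = card (sieve S {P} N) + card S * CARD('a) ^ (N - degree (P ^ e)) * card units"
    and prod_sieve_Suc: "[\<Prod>(sieve S {P} (Suc N)) = \<Prod>(sieve S {P} N)
      * \<Prod>units ^ (card S * CARD('a) ^ (N - degree (P ^ e)))] (mod P ^ e)"
proof -
  define B where "B = {g. degree g = N \<and> lead_coeff g \<in> S \<and> \<not> P dvd g}"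
  define L where "L = {l. degree l = N - degree (P ^ e) \<and> lead_coeff l \<in> S}"
  have split: "sieve S {P} (Suc N) = sieve S {P} N \<union> B"
    by (auto simp: sieve_def B_def)
  have disj: "sieve S {P} N \<inter> B = {}"
    by (auto simp: sieve_def B_def)
  have "finite B"
    by (rule finite_subset[OF _ finite_sieve[of S "{P}" "Suc N"]]) (auto simp: sieve_def B_def)
  have cardL: "card L = card S * CARD('a) ^ (N - degree (P ^ e))"
    unfolding L_def by (rule card_degree_lead_coeff) fact
  have bij: "bij_betw (\<lambda>(l, r). r + P ^ e * l) (L \<times> units) B"
    unfolding L_def units_def B_def
    by (rule division_bij) (use monic_power degree_pos dvd_power_self N S in auto)
  have "card B = card L * card units"
    using bij_betw_same_card[OF bij] by (simp add: card_cartesian_product)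
  then show "card (sieve S {P} (Suc N))
      = card (sieve S {P} N) + card S * CARD('a) ^ (N - degree (P ^ e)) * card units"
    unfolding split using disj \<open>finite B\<close> by (simp add: card_Un_disjoint cardL)
  have "\<Prod>B = (\<Prod>x\<in>L \<times> units. case x of (l, r) \<Rightarrow> r + P ^ e * l)"
    using prod.reindex_bij_betw[OF bij, of "\<lambda>x. x"] by simp
  \<comment> \<open>Modulo \<open>P ^ e\<close> only the remainder survives.\<close>
  also have "[\<dots> = (\<Prod>x\<in>L \<times> units. snd x)] (mod P ^ e)"
    by (intro cong_prod) (auto simp: cong_iff_dvd_diff)
  also have "(\<Prod>x\<in>L \<times> units. snd x) = \<Prod>units ^ card L"
    using prod.cartesian_product[of "\<lambda>l r. r" units L] by (simp add: case_prod_beta')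
  finally have "[\<Prod>B = \<Prod>units ^ card L] (mod P ^ e)" .
  then show "[\<Prod>(sieve S {P} (Suc N)) = \<Prod>(sieve S {P} N)
      * \<Prod>units ^ (card S * CARD('a) ^ (N - degree (P ^ e)))] (mod P ^ e)"
    unfolding split using disj \<open>finite B\<close>
    by (simp add: prod.union_disjoint cardL cong_scalar_left)
qed

lemma card_sieve_single:
  assumes "degree (P ^ e) \<le> M" "M \<le> N" "0 \<notin> S"
  shows "[card (sieve S {P} N) = card (sieve S {P} M)] (mod card units)"
  using assms(2)
proof (induction N rule: dec_induct)
  case (step n)
  then show ?case
    using card_sieve_Suc[of n S] assms by (simp add: cong_def)
qed simp

text \<open>Every layer contributes \<open>\<Prod>units\<close> to the power \<open>card S\<close>
  times a power of \<open>CARD('a)\<close>. The latter is odd and \<open>\<Prod>units\<close>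
  squares to 1, so the factor is always \<open>\<Prod>units ^ card S\<close>.\<close>

lemma prod_sieve_single:
  assumes "degree (P ^ e) \<le> M" "0 \<notin> S" "odd CARD('a)"
  shows "[\<Prod>(sieve S {P} (M + k)) = \<Prod>(sieve S {P} M) * \<Prod>units ^ (card S * k)] (mod P ^ e)"
proof (induction k)
  case (Suc k)
  have "[\<Prod>(sieve S {P} (M + Suc k)) = \<Prod>(sieve S {P} (M + k))
      * \<Prod>units ^ (card S * CARD('a) ^ (M + k - degree (P ^ e)))] (mod P ^ e)"
    using prod_sieve_Suc[of "M + k" S] assms by simp
  also have "[\<Prod>(sieve S {P} (M + k)) * \<Prod>units ^ (card S * CARD('a) ^ (M + k - degree (P ^ e)))
      = \<Prod>(sieve S {P} M) * \<Prod>units ^ (card S * k) * \<Prod>units ^ card S] (mod P ^ e)"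
    by (rule cong_mult[OF Suc power_prod_units_cong]) (use assms(3) in simp)
  finally show ?case by (simp add: power_add algebra_simps)
qed simp

lemma not_dvd_prod_sieve: "P \<in> X \<Longrightarrow> \<not> P dvd \<Prod>(sieve S X N)"
  by (rule not_dvd_prod) (simp add: sieve_def)

section \<open>Sieving by further primes\<close>

text \<open>The recursion compares the sieve by \<open>P\<close> at \<open>N\<close> and at
  \<open>N - degree p\<close>. The counts there agree modulo \<open>card units\<close>, and the
  products differ by a factor that does not depend on \<open>N\<close>. The lower bound on
  \<open>N\<close> keeps \<open>N - degree p\<close> in the range where this holds.\<close>

lemma sieve_two:
  assumes p: "lead_coeff p = 1" "\<not> P dvd p" and S: "0 \<notin> S" and odd: "odd CARD('a)"
    and M: "M \<ge> degree (P ^ e) + degree p" and N: "N \<ge> degree (P ^ e) + degree p"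
  shows "card units dvd card (sieve S {p, P} N)"
    and "[\<Prod>(sieve S {p, P} M) = \<Prod>(sieve S {p, P} N)] (mod P ^ e)"
proof -
  have X: "\<forall>x\<in>{P}. prime_elem x \<and> \<not> x dvd p" using p prime by simp
  note card = card_sieve_insert[OF p(1) X] and prod = prod_sieve_insert[OF p(1) X]
  have "[card (sieve S {p, P} N) + card (sieve S {P} (N - degree p))
      = 0 + card (sieve S {P} (N - degree p))] (mod card units)"
    using card_sieve_single[of "N - degree p" N S] N S card[where S = S and N = N] by simp
  then show "card units dvd card (sieve S {p, P} N)"
    by (simp only: cong_add_rcancel_nat cong_0_iff)
  \<comment> \<open>A fixed representative of the count modulo \<open>card units\<close>: by
    \<open>fermat\<close>, \<open>p ^ c\<close> can replace the power of \<open>p\<close> in the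
    recursion for every admissible \<open>N\<close>.\<close>
  define c where "c = card (sieve S {P} (degree (P ^ e)))"
  \<comment> \<open>The right-hand side is free of \<open>N\<close>, and \<open>p ^ c\<close> can be
    cancelled.\<close>
  have *: "[p ^ c * \<Prod>(sieve S {p, P} N) = \<Prod>units ^ (card S * degree p)] (mod P ^ e)"
    if N: "N \<ge> degree (P ^ e) + degree p" for N
  proof -
    define F where "F = \<Prod>(sieve S {P} (N - degree p))"
    have "[p ^ c = p ^ card (sieve S {P} (N - degree p))] (mod P ^ e)"
      unfolding c_def
      by (rule power_cong_exponent[OF p(2)], rule cong_sym, rule card_sieve_single)
         (use N S in auto)
    then have "[F * (p ^ c * \<Prod>(sieve S {p, P} N)) =
        F * (p ^ card (sieve S {P} (N - degree p)) * \<Prod>(sieve S {p, P} N))] (mod P ^ e)"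
      by (intro cong_mult cong_refl)
    also have "F * (p ^ card (sieve S {P} (N - degree p)) * \<Prod>(sieve S {p, P} N))
        = \<Prod>(sieve S {P} N)"
      using prod[where S = S and N = N] by (simp add: F_def mult_ac)
    also have "[\<dots> = F * \<Prod>units ^ (card S * degree p)] (mod P ^ e)"
      using prod_sieve_single[of "N - degree p" S "degree p"] N S odd by (simp add: F_def)
    finally show ?thesis
      by (rule cong_cancel) (simp add: F_def not_dvd_prod_sieve)
  qed
  show "[\<Prod>(sieve S {p, P} M) = \<Prod>(sieve S {p, P} N)] (mod P ^ e)"
    using cong_cancel[OF cong_trans[OF *[OF M] cong_sym[OF *[OF N]]] not_dvd_power[OF p(2)]] .
qed

text \<open>The claims are proved together: for a new prime \<open>p\<close>, divisibility of the
  old count makes the power of \<open>p\<close> in the recursion congruent to 1, and independence of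
  the bound lets the two old products cancel. What remains is the new product, congruent to
  1.\<close>

lemma sieve_many:
  assumes "finite Y" "Y \<noteq> {}" and S: "0 \<notin> S" and odd: "odd CARD('a)"
    and Y: "\<And>p. p \<in> Y \<Longrightarrow> prime_elem p \<and> lead_coeff p = 1"
    and ndvd: "\<And>p r. p \<in> insert P Y \<Longrightarrow> r \<in> Y \<Longrightarrow> p \<noteq> r \<Longrightarrow> \<not> p dvd r"
    and "P \<notin> Y"
    and "M \<ge> degree (P ^ e) + (\<Sum>p\<in>Y. degree p)" "N \<ge> degree (P ^ e) + (\<Sum>p\<in>Y. degree p)"
  shows "card units dvd card (sieve S (insert P Y) N)
    \<and> [\<Prod>(sieve S (insert P Y) M) = \<Prod>(sieve S (insert P Y) N)] (mod P ^ e)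
    \<and> (card Y \<ge> 2 \<longrightarrow> [\<Prod>(sieve S (insert P Y) N) = 1] (mod P ^ e))"
  using assms(1,2,5-)
proof (induction Y arbitrary: M N rule: finite_ne_induct)
  \<comment> \<open>With one prime besides \<open>P\<close> the last claim is vacuous.\<close>
  case (singleton p)
  then have "lead_coeff p = 1" "\<not> P dvd p" by auto
  from sieve_two[OF this S odd, of M N] singleton show ?case
    by (simp add: insert_commute)
next
  case (insert p Y)
  have X: "\<forall>x\<in>insert P Y. prime_elem x \<and> \<not> x dvd p" and p: "lead_coeff p = 1"
    using insert.prems prime insert.hyps by auto
  note card = card_sieve_insert[OF p X] and prod = prod_sieve_insert[OF p X]
  have IH: "card units dvd card (sieve S (insert P Y) N)"
     "[\<Prod>(sieve S (insert P Y) M) = \<Prod>(sieve S (insert P Y) N)] (mod P ^ e)"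
    if "M \<ge> degree (P ^ e) + (\<Sum>p\<in>Y. degree p)" "N \<ge> degree (P ^ e) + (\<Sum>p\<in>Y. degree p)" for M N
    using insert.IH[of M N] insert.prems that by auto
  \<comment> \<open>Congruence to 1 at every admissible bound also yields independence of the
    bound.\<close>
  have *: "card units dvd card (sieve S (insert p (insert P Y)) N)"
    "[\<Prod>(sieve S (insert p (insert P Y)) N) = 1] (mod P ^ e)"
    if "N \<ge> degree (P ^ e) + (\<Sum>p\<in>insert p Y. degree p)" for N
  proof -
    have le: "N \<ge> degree (P ^ e) + (\<Sum>p\<in>Y. degree p)"
      "N - degree p \<ge> degree (P ^ e) + (\<Sum>p\<in>Y. degree p)"
      using that insert.hyps by simp_all
    show "card units dvd card (sieve S (insert p (insert P Y)) N)"
      using IH(1)[OF le] IH(1)[OF le(2) le(1)] IH(1)[OF le(2) le(2)] card[where S = S and N = N]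
      by (metis dvd_add_left_iff)
    define F where "F = \<Prod>(sieve S (insert P Y) (N - degree p))"
    define c where "c = card (sieve S (insert P Y) (N - degree p))"
    have "[c = 0] (mod card units)"
      using IH(1)[OF le(2) le(2)] by (simp add: c_def cong_0_iff)
    then have "[p ^ c = 1] (mod P ^ e)"
      using power_cong_exponent[of p c 0] X by simp
    define R where "R = \<Prod>(sieve S (insert p (insert P Y)) N)"
    have "\<Prod>(sieve S (insert P Y) N) = F * R * p ^ c"
      using prod[where S = S and N = N] by (simp add: F_def R_def c_def mult_ac)
    also have "[F * R * p ^ c = F * R * 1] (mod P ^ e)"
      by (rule cong_scalar_left) fact
    finally have "[F * R * 1 = F] (mod P ^ e)"
      using IH(2)[OF le] unfolding F_def by (blast intro: cong_sym cong_trans)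
    then have "[F * R = F * 1] (mod P ^ e)"
      by simp
    then have "[R = 1] (mod P ^ e)"
      by (rule cong_cancel) (simp add: F_def not_dvd_prod_sieve)
    then show "[\<Prod>(sieve S (insert p (insert P Y)) N) = 1] (mod P ^ e)"
      by (simp only: R_def)
  qed
  have eq: "insert P (insert p Y) = insert p (insert P Y)" by blast
  show ?case
    unfolding eq using *[OF insert.prems(4)] *[OF insert.prems(5)]
    by (blast intro: cong_sym cong_trans)
qed

end

section \<open>Divisibility and products of prime powers\<close>

text \<open>In \<open>P ^ n * y = c * z\<close> the prime \<open>P\<close> does not divide
  \<open>c\<close>, so \<open>P ^ n\<close> divides \<open>z\<close> and cancels.\<close>

lemma prime_power_dvd_cancel:
  fixes P :: "'a::field poly"
  assumes "prime_elem P" "\<not> P dvd c" "c dvd P ^ n * y"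
  shows "c dvd y"
proof (cases "n = 0")
  case False
  obtain z where z: "P ^ n * y = c * z" using assms(3) by auto
  have "P ^ n dvd z"
    using prime_power_dvd_multD[OF assms(1), of n c z] z False assms(2) by (metis dvd_triv_left neq0_conv)
  then obtain w where "z = P ^ n * w" by auto
  then have "P ^ n * y = P ^ n * (c * w)" using z by (simp add: mult_ac)
  then have "y = c * w" using assms(1) by simp
  then show ?thesis by simp
qed (use assms in simp)

text \<open>The quotient would be a unit, hence a constant, and comparing leading coefficients makes
  it 1.\<close>

lemma not_dvd_distinct_monic_irreducible:
  fixes p :: "'a::field poly"
  assumes "irreducible p" "irreducible r" "lead_coeff p = 1" "lead_coeff r = 1" "p \<noteq> r"
  shows "\<not> p dvd r"
proof
  assume "p dvd r"
  then obtain k where k: "r = p * k" by auto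
  then have "is_unit k"
    using irreducibleD[OF assms(2) k] irreducible_not_unit[OF assms(1)] by blast
  then obtain c where c: "k = [:c:]" by (auto simp: is_unit_poly_iff)
  have "lead_coeff k = 1"
    using assms(3,4) k by (metis lead_coeff_mult mult_1_left)
  with c k assms(5) show False by (simp add: one_pCons)
qed

text \<open>This glues the congruences modulo the single prime powers: \<open>P i\<close> does not
  divide the product collected so far, so \<open>P i ^ e i\<close> divides its cofactor in
  \<open>x\<close>.\<close>

lemma prime_powers_prod_dvd:
  fixes P :: "'b \<Rightarrow> 'a::field poly"
  assumes "finite J" "\<And>i. i \<in> J \<Longrightarrow> prime_elem (P i)"
    and "\<And>i j. i \<in> J \<Longrightarrow> j \<in> J \<Longrightarrow> i \<noteq> j \<Longrightarrow> \<not> P i dvd P j"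
    and "\<And>i. i \<in> J \<Longrightarrow> P i ^ e i dvd x"
  shows "(\<Prod>i\<in>J. P i ^ e i) dvd x"
  using assms
proof (induction J rule: finite_induct)
  case (insert i J)
  then obtain y where y: "x = (\<Prod>i\<in>J. P i ^ e i) * y" by auto
  have "\<not> P i dvd (\<Prod>j\<in>J. P j ^ e j)"
    using insert.hyps insert.prems(1)[of i] insert.prems(2)[of i]
    by (intro prime_elem_not_dvd_prod) (auto dest: prime_elem_dvd_power)
  moreover have "P i ^ e i dvd (\<Prod>j\<in>J. P j ^ e j) * y"
    unfolding y[symmetric] by (rule insert.prems(3)) simp
  ultimately have "P i ^ e i dvd y"
    using insert.prems(1)[of i] prime_power_dvd_multD[of "P i" "e i" _ y]
    by (cases "e i = 0") simp_all
  then show ?case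
    using insert.hyps by (simp add: y mult.commute mult_dvd_mono)
qed simp

text \<open>No \<open>P i\<close> divides a common divisor \<open>c\<close>, so the prime powers are
  stripped off one by one until \<open>c dvd 1\<close>.\<close>

lemma coprime_prime_powers:
  fixes P :: "'b \<Rightarrow> 'a::field poly"
  assumes "finite J" "\<And>i. i \<in> J \<Longrightarrow> prime_elem (P i)" "\<And>i. i \<in> J \<Longrightarrow> \<not> P i dvd g"
  shows "coprime g (\<Prod>i\<in>J. P i ^ e i)"
proof (rule coprimeI)
  fix c assume c: "c dvd g" "c dvd (\<Prod>i\<in>J. P i ^ e i)"
  show "is_unit c"
    using assms c(2)
  proof (induction J rule: finite_induct)
    case (insert i J)
    then have "\<not> P i dvd c" using c(1) dvd_trans by blast
    moreover have "c dvd P i ^ e i * (\<Prod>i\<in>J. P i ^ e i)"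
      using insert.prems(3) insert.hyps by simp
    ultimately have "c dvd (\<Prod>i\<in>J. P i ^ e i)"
      using insert.prems(1) by (blast intro: prime_power_dvd_cancel[of "P i" c "e i"])
    then show ?case
      using insert.IH insert.prems(1,2) by blast
  qed simp
qed

section \<open>Assembling the congruence modulo \<open>f\<close>\<close>

theorem theorem4p9:
  fixes f :: "'a::{field,finite} poly"
    and S :: "'a set"
    and a :: 'a
    and P :: "nat \<Rightarrow> 'a poly"
    and e :: "nat \<Rightarrow> nat"
    and q t :: nat
  assumes "CARD('a) = q" and "odd q"
    and "S \<subseteq> UNIV - {0}"
    and "card S = (q - 1) div 2"
    and "\<And>\<alpha>. \<alpha> \<in> S \<Longrightarrow> - \<alpha> \<notin> S"
    and "f = smult a (\<Prod>j=1..t. P j ^ e j)"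
    and "a \<noteq> 0"
    and "inj_on P {1..t}"
    and "\<And>j. j \<in> {1..t} \<Longrightarrow> irreducible (P j) \<and> lead_coeff (P j) = 1"
    and "\<And>j. j \<in> {1..t} \<Longrightarrow> e j \<ge> 1"
    and "t \<ge> 3"
  shows "[G f S = 1] (mod f)"
proof -
  let ?J = "{1..t}"
  have S0: "0 \<notin> S" using assms(3) by auto
  have prime_P: "prime_elem (P j)" "lead_coeff (P j) = 1" if "j \<in> ?J" for j
    using assms(9)[OF that] field_poly_irreducible_imp_prime by auto
  have ndvd: "\<not> P i dvd P j" if "i \<in> ?J" "j \<in> ?J" "i \<noteq> j" for i j
    using assms(9)[OF that(1)] assms(9)[OF that(2)] inj_onD[OF assms(8)] that
    by (intro not_dvd_distinct_monic_irreducible) auto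
  \<comment> \<open>The constant \<open>a\<close> is a unit, so \<open>f\<close> and the product of
    prime powers have the same divisors and the same multiples.\<close>
  have dvd_f: "x dvd f \<longleftrightarrow> x dvd (\<Prod>j\<in>?J. P j ^ e j)" for x
    using assms(7) by (simp add: assms(6) dvd_smult_iff)
  have f_dvd: "f dvd x \<longleftrightarrow> (\<Prod>j\<in>?J. P j ^ e j) dvd x" for x
    using assms(7) by (simp add: assms(6) smult_dvd_iff)
  have Pdvd: "P j dvd f" if "j \<in> ?J" for j
    using that assms(10)[OF that] dvd_prodI[of ?J j "\<lambda>j. P j ^ e j"]
    unfolding dvd_f by (auto intro: dvd_trans[OF dvd_power])
  have "coprime g f \<longleftrightarrow> (\<forall>p\<in>P ` ?J. \<not> p dvd g)" for g
  proof
    assume "coprime g f"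
    then show "\<forall>p\<in>P ` ?J. \<not> p dvd g"
      using Pdvd prime_P by (auto dest: coprime_common_divisor simp: prime_elem_not_unit)
  next
    assume "\<forall>p\<in>P ` ?J. \<not> p dvd g"
    then have "coprime g (\<Prod>j\<in>?J. P j ^ e j)"
      using prime_P by (intro coprime_prime_powers) auto
    then show "coprime g f"
      unfolding coprime_def dvd_f .
  qed
  then have index: "G_index f S = sieve S (P ` ?J) (degree f)"
    by (simp add: G_index_def sieve_def)
  have nz: "P j \<noteq> 0" if "j \<in> ?J" for j using prime_P(2)[OF that] by auto
  have "degree (\<Prod>j\<in>?J. P j ^ e j) = (\<Sum>j\<in>?J. degree (P j ^ e j))"
    using nz by (intro degree_prod_sum_eq) auto
  also have "\<dots> = (\<Sum>j\<in>?J. e j * degree (P j))"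
    using nz by (intro sum.cong) (auto simp: degree_power_eq)
  finally have deg: "degree f = (\<Sum>j\<in>?J. e j * degree (P j))"
    using assms(7) by (simp add: assms(6))
  have main: "[G f S = 1] (mod P i ^ e i)" if i: "i \<in> ?J" for i
  proof -
    interpret prime_power "P i" "e i"
      using prime_P[OF i] assms(10)[OF i] by unfold_locales auto
    define Y where "Y = P ` (?J - {i})"
    have inj: "inj_on P (?J - {i})" by (rule inj_on_subset[OF assms(8)]) auto
    have cardY: "card Y = t - 1"
      using i unfolding Y_def card_image[OF inj] by simp
    have "(\<Sum>p\<in>Y. degree p) = (\<Sum>j\<in>?J - {i}. degree (P j))"
      unfolding Y_def by (simp only: sum.reindex[OF inj] o_def)
    also have "\<dots> \<le> (\<Sum>j\<in>?J - {i}. e j * degree (P j))"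
      using assms(10) by (intro sum_mono) auto
    \<comment> \<open>The bound \<open>degree f\<close> reaches the threshold of
      \<open>sieve_many\<close>: the \<open>i\<close>-th summand of \<open>degree f\<close> is
      \<open>degree (P i ^ e i)\<close>, and every other one is at least \<open>degree (P j)\<close>
      because \<open>e j \<ge> 1\<close>.\<close>
    finally have le: "degree (P i ^ e i) + (\<Sum>p\<in>Y. degree p) \<le> degree f"
      using i nz[OF i] unfolding deg sum.remove[OF finite_atLeastAtMost i]
      by (simp add: degree_power_eq)
    \<comment> \<open>Here \<open>t \<ge> 3\<close> enters: two primes besides \<open>P i\<close>
      are required for the product to become 1.\<close>
    have "card Y \<ge> 2" "odd CARD('a)" using cardY assms(1,2,11) by simp_all
    moreover from \<open>card Y \<ge> 2\<close> have "Y \<noteq> {}" by auto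
    moreover have "finite Y" by (simp add: Y_def)
    moreover have "P i \<notin> Y"
      unfolding Y_def using i inj_on_eq_iff[OF assms(8)] by (auto simp del: One_nat_def)
    moreover have "P ` ?J = insert (P i) Y" using i by (auto simp: Y_def)
    moreover have "\<not> p dvd r" if "p \<in> insert (P i) Y" "r \<in> Y" "p \<noteq> r" for p r
      using that i ndvd unfolding Y_def by blast
    moreover have "prime_elem p \<and> lead_coeff p = 1" if "p \<in> Y" for p
      using that prime_P unfolding Y_def by blast
    ultimately show ?thesis
      using sieve_many[of Y S "degree f" "degree f"] S0 le by (simp add: G_def index)
  qed
  have "(\<Prod>j\<in>?J. P j ^ e j) dvd G f S - 1"
    using prime_P ndvd main by (intro prime_powers_prod_dvd) (auto simp: cong_iff_dvd_diff)
  then show ?thesis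
    by (simp add: cong_iff_dvd_diff f_dvd)
qed

end
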